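(* Let $X$ be a Banach space and let $Y$ be a closed subspace of $X$ such that $X/Y$ is finite dimensional and $Y$ has $BHP$. Then $X$ has $BHP$.
   Context: The Banach spaces $X$ and $Y$ are real and nontrivial. For a Banach space $E$, $B_E$ is the closed unit ball. $E$ has the Ball Huskable Property ($BHP$) if for every $\varepsilon>0$ there is a nonempty relatively weakly open subset of $B_E$ with diameter less than $\varepsilon$. *)

theory Defs
  imports "HOL-Analysis.Analysis" "HOL-Library.Set_Algebras"
begin

text \<open>
  A Banach space in the statement is a closed subspace \<open>E\<close> of a type of class \<open>banach\<close>, with the
  whole space being \<open>UNIV\<close>.  The dual and the weak topology below are intrinsic to \<open>E\<close>: only the
  values of a functional on \<open>E\<close> matter, and no extension to the ambient space is required.
\<close>

definition dual_on :: "'a::real_normed_vector set \<Rightarrow> ('a \<Rightarrow> real) set" where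
  "dual_on E = {f. (\<forall>x\<in>E. \<forall>y\<in>E. f (x + y) = f x + f y) \<and>
                   (\<forall>c. \<forall>x\<in>E. f (c *\<^sub>R x) = c * f x) \<and>
                   (\<exists>K. \<forall>x\<in>E. \<bar>f x\<bar> \<le> K * norm x)}"

lemma dual_on_UNIV: "dual_on UNIV = {f :: 'a::real_normed_vector \<Rightarrow> real. bounded_linear f}"
  by (auto simp: dual_on_def mult.commute linear_iff
      bounded_linear_def bounded_linear_axioms_def)

definition weak_topology_on :: "'a::real_normed_vector set \<Rightarrow> 'a topology" where
  "weak_topology_on E =
     topology_generated_by {{x \<in> E. f x \<in> U} | f U. f \<in> dual_on E \<and> open U}"

lemma topspace_weak_topology_on [simp]: "topspace (weak_topology_on E) = E"
proof -
  have "(\<lambda>_. 0) \<in> dual_on E"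
    by (auto simp: dual_on_def intro!: exI[of _ 0])
  then have "\<exists>f U. E = {x \<in> E. f x \<in> U} \<and> f \<in> dual_on E \<and> open U"
    by (intro exI[of _ "\<lambda>_. 0"] exI[of _ UNIV]) auto
  then show ?thesis
    unfolding weak_topology_on_def topology_generated_by_topspace by blast
qed

definition unit_ball_of :: "'a::real_normed_vector set \<Rightarrow> 'a set" where
  "unit_ball_of E = {x \<in> E. norm x \<le> 1}"

definition ball_huskable :: "'a::real_normed_vector set \<Rightarrow> bool" where
  "ball_huskable E \<longleftrightarrow>
     (\<forall>\<epsilon>>0. \<exists>W. openin (subtopology (weak_topology_on E) (unit_ball_of E)) W \<and>
               W \<noteq> {} \<and> diameter W < \<epsilon>)"

text \<open>
  The quotient by \<open>Y\<close> is the set of cosets of \<open>Y\<close>.  Addition of cosets is the elementwise sum of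
  sets and the zero is \<open>Y\<close> itself.  In the scalar multiplication the summand \<open>Y\<close> matters only for
  the scalar 0, where the image alone would be \<open>{0}\<close>.
\<close>

definition quotient_by :: "'a::real_vector set \<Rightarrow> 'a set set" where
  "quotient_by Y = range (\<lambda>x. x +o Y)"

definition quotient_scale :: "'a::real_vector set \<Rightarrow> real \<Rightarrow> 'a set \<Rightarrow> 'a set" where
  "quotient_scale Y c A = (\<lambda>x. c *\<^sub>R x) ` A + Y"

lemma quotient_add_coset:
  assumes "subspace Y"
  shows "(x +o Y) + (y +o Y) = (x + y) +o Y"
proof -
  have "Y + Y = Y"
  proof
    show "Y + Y \<subseteq> Y"
      using assms by (auto simp: set_plus_def intro: subspace_add)
    show "Y \<subseteq> Y + Y"
      using set_zero_plus2[OF subspace_0[OF assms]] .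
  qed
  then show ?thesis
    by (metis set_plus_rearrange)
qed

lemma quotient_scale_coset:
  assumes "subspace Y"
  shows "quotient_scale Y c (x +o Y) = (c *\<^sub>R x) +o Y"
proof
  show "quotient_scale Y c (x +o Y) \<subseteq> (c *\<^sub>R x) +o Y"
  proof
    fix z assume "z \<in> quotient_scale Y c (x +o Y)"
    then obtain y y' where "y \<in> Y" "y' \<in> Y" "z = c *\<^sub>R (x + y) + y'"
      by (auto simp: quotient_scale_def elt_set_plus_def set_plus_def)
    then have "z = c *\<^sub>R x + (c *\<^sub>R y + y')" "c *\<^sub>R y + y' \<in> Y"
      using assms by (auto simp: scaleR_add_right intro: subspace_add subspace_scale)
    then show "z \<in> (c *\<^sub>R x) +o Y"
      by (auto simp: elt_set_plus_def)
  qed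
  show "(c *\<^sub>R x) +o Y \<subseteq> quotient_scale Y c (x +o Y)"
  proof
    fix z assume "z \<in> (c *\<^sub>R x) +o Y"
    then obtain y where y: "y \<in> Y" "z = c *\<^sub>R x + y"
      by (auto simp: elt_set_plus_def)
    have "x \<in> x +o Y"
      using subspace_0[OF assms] by (force simp: elt_set_plus_def)
    then show "z \<in> quotient_scale Y c (x +o Y)"
      using y unfolding quotient_scale_def by (auto intro: set_plus_intro)
  qed
qed

inductive_set quotient_span :: "'a::real_vector set \<Rightarrow> 'a set set \<Rightarrow> 'a set set"
  for Y :: "'a set" and G :: "'a set set" where
  zero: "Y \<in> quotient_span Y G"
| base: "A \<in> G \<Longrightarrow> A \<in> quotient_span Y G"
| add: "A \<in> quotient_span Y G \<Longrightarrow> B \<in> quotient_span Y G \<Longrightarrow> A + B \<in> quotient_span Y G"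
| scale: "A \<in> quotient_span Y G \<Longrightarrow> quotient_scale Y c A \<in> quotient_span Y G"

definition finite_dim_quotient :: "'a::real_vector set \<Rightarrow> bool" where
  "finite_dim_quotient Y \<longleftrightarrow>
     (\<exists>G. finite G \<and> G \<subseteq> quotient_by Y \<and> quotient_span Y G = quotient_by Y)"

end

theory Submission
  imports Defs
begin

text \<open>
  The quotient is spanned by finitely many cosets, so \<open>X\<close> is reached from \<open>Y\<close> by adjoining finitely
  many vectors, and it suffices to adjoin one vector \<open>e \<notin> Y\<close>.  Because \<open>Y\<close> is closed, the coordinate
  \<open>g\<close> along \<open>e\<close> is bounded.  The condition \<open>\<bar>g z\<bar> * norm e < \<eta>\<close> is weakly open, and on the part of
  the ball where it holds the map \<open>z \<mapsto> (z - g z *\<^sub>R e) / (1 + \<eta>)\<close> is weakly continuous into the ball of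
  \<open>Y\<close> and moves points by at most \<open>2\<eta>\<close>.  So the preimage of a small relatively weakly open set
  is again small and relatively weakly open.
\<close>

section \<open>Dual of a subspace and continuity for weak topologies\<close>

lemma dual_onI:
  assumes "\<And>x y. x \<in> E \<Longrightarrow> y \<in> E \<Longrightarrow> f (x + y) = f x + f y"
    and "\<And>c x. x \<in> E \<Longrightarrow> f (c *\<^sub>R x) = c * f x"
    and "\<And>x. x \<in> E \<Longrightarrow> \<bar>f x\<bar> \<le> K * norm x"
  shows "f \<in> dual_on E"
  using assms unfolding dual_on_def by blast

text \<open>Apply the bound to \<open>x - y\<close>, which stays in \<open>E\<close> because
  \<open>E\<close> is a subspace; outside \<open>E\<close> nothing is known about
  \<open>f\<close>.\<close>

lemma dual_on_lipschitz:
  assumes "f \<in> dual_on E" "subspace E"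
  obtains K where "K-lipschitz_on E f"
proof -
  obtain K where K: "\<And>x. x \<in> E \<Longrightarrow> \<bar>f x\<bar> \<le> K * norm x"
    using assms(1) unfolding dual_on_def by blast
  have add: "\<And>x y. x \<in> E \<Longrightarrow> y \<in> E \<Longrightarrow> f (x + y) = f x + f y"
    using assms(1) by (auto simp: dual_on_def)
  \<comment> \<open>A Lipschitz constant has to be nonnegative, but \<open>K\<close> can be negative
    when \<open>E\<close> is \<open>{0}\<close>.\<close>
  have "\<bar>K\<bar>-lipschitz_on E f"
  proof (rule lipschitz_onI)
    fix x y assume xy: "x \<in> E" "y \<in> E"
    then have d: "x - y \<in> E"
      using assms(2) by (intro subspace_diff)
    have "f x = f (x - y) + f y"
      using add[OF d xy(2)] by simp
    then have "dist (f x) (f y) = \<bar>f (x - y)\<bar>"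
      by (simp add: dist_real_def)
    also have "\<dots> \<le> K * norm (x - y)"
      by (rule K[OF d])
    also have "\<dots> \<le> \<bar>K\<bar> * dist x y"
      by (simp add: dist_norm mult_right_mono)
    finally show "dist (f x) (f y) \<le> \<bar>K\<bar> * dist x y" .
  qed simp
  then show thesis ..
qed

lemma openin_weak_topology_on_vimage:
  assumes "f \<in> dual_on E" "open U"
  shows "openin (weak_topology_on E) {x \<in> E. f x \<in> U}"
  unfolding weak_topology_on_def
  by (rule topology_generated_by_Basis) (use assms in blast)

text \<open>Continuity into a generated topology can be tested on the generating sets alone.\<close>

lemma continuous_map_into_weak_topology_on:
  assumes "\<phi> ` topspace T \<subseteq> E"
    and "\<And>f U. f \<in> dual_on E \<Longrightarrow> open U \<Longrightarrow> openin T {x \<in> topspace T. f (\<phi> x) \<in> U}"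
  shows "continuous_map T (weak_topology_on E) \<phi>"
  unfolding weak_topology_on_def
proof (rule continuous_on_generated_topo)
  fix S assume "S \<in> {{x \<in> E. f x \<in> U} |f U. f \<in> dual_on E \<and> open U}"
  then obtain f U where S: "S = {x \<in> E. f x \<in> U}" "f \<in> dual_on E" "open U"
    by blast
  have "\<phi> -` S \<inter> topspace T = {x \<in> topspace T. f (\<phi> x) \<in> U}"
    using assms(1) S(1) by auto
  then show "openin T (\<phi> -` S \<inter> topspace T)"
    using assms(2)[OF S(2,3)] by simp
next
  show "\<phi> ` topspace T \<subseteq> \<Union> {{x \<in> E. f x \<in> U} |f U. f \<in> dual_on E \<and> open U}"
    using assms(1) topspace_weak_topology_on[of E]
    unfolding weak_topology_on_def topology_generated_by_topspace by simp
qed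

text \<open>The norm topology is finer than the weak one, so a weakly open set tolerates small norm
  perturbations of its points.\<close>

lemma continuous_map_norm_weak:
  assumes "subspace E"
  shows "continuous_map (top_of_set E) (weak_topology_on E) (\<lambda>x. x)"
proof (rule continuous_map_into_weak_topology_on)
  fix f :: "'a \<Rightarrow> real" and U :: "real set" assume f: "f \<in> dual_on E" and "open U"
  then have "openin (top_of_set E) (E \<inter> f -` U)"
    using continuous_openin_preimage_gen lipschitz_on_continuous_on
    by (metis dual_on_lipschitz[OF f assms])
  then show "openin (top_of_set E) {x \<in> topspace (top_of_set E). f x \<in> U}"
    by (simp add: Int_def vimage_def)
qed simp

lemma continuous_map_weak_weak:
  assumes "\<And>x. x \<in> E \<Longrightarrow> \<phi> x \<in> F"
    and "\<And>f. f \<in> dual_on F \<Longrightarrow> (\<lambda>x. f (\<phi> x)) \<in> dual_on E"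
  shows "continuous_map (weak_topology_on E) (weak_topology_on F) \<phi>"
  using assms
  by (intro continuous_map_into_weak_topology_on)
     (auto intro: openin_weak_topology_on_vimage[OF assms(2)])

section \<open>The coordinate along an adjoined vector\<close>

text \<open>Closedness of \<open>Y\<close> enters as \<open>setdist {e} Y > 0\<close>, whose inverse bounds the coordinate.\<close>

lemma coordinate_functional:
  fixes Y :: "'a::real_normed_vector set"
  assumes "subspace Y" "closed Y" "e \<notin> Y"
  obtains g where "g \<in> dual_on (span (insert e Y))"
    and "\<And>z. z \<in> span (insert e Y) \<Longrightarrow> z - g z *\<^sub>R e \<in> Y"
    and "\<And>y. y \<in> Y \<Longrightarrow> g y = 0"
proof -
  let ?Z = "span (insert e Y)"
  have Z: "z \<in> ?Z \<longleftrightarrow> (\<exists>k. z - k *\<^sub>R e \<in> Y)" for z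
    using assms(1) by (simp add: span_insert span_eq_iff[THEN iffD2])
  \<comment> \<open>Two different coordinates of one vector would put a nonzero multiple of
    \<open>e\<close>, hence \<open>e\<close> itself, into \<open>Y\<close>.\<close>
  have uniq: "k = l" if "z - k *\<^sub>R e \<in> Y" "z - l *\<^sub>R e \<in> Y" for z k l
  proof (rule ccontr)
    assume "k \<noteq> l"
    have "(z - k *\<^sub>R e) - (z - l *\<^sub>R e) \<in> Y"
      by (rule subspace_diff[OF assms(1) that])
    then have "(l - k) *\<^sub>R e \<in> Y"
      by (simp add: algebra_simps)
    then have "(1 / (l - k)) *\<^sub>R ((l - k) *\<^sub>R e) \<in> Y"
      by (rule subspace_scale[OF assms(1)])
    with \<open>k \<noteq> l\<close> assms(3) show False by simp
  qed
  \<comment> \<open>On the span the choice is forced by \<open>uniq\<close>; elsewhere it is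
    arbitrary, which \<open>dual_on\<close> ignores.\<close>
  define g where "g z = (SOME k. z - k *\<^sub>R e \<in> Y)" for z
  have gY: "z - g z *\<^sub>R e \<in> Y" if "z \<in> ?Z" for z
    using that unfolding Z g_def by (rule someI_ex)
  have geq: "g z = k" if "z - k *\<^sub>R e \<in> Y" for z k
    using uniq[OF gY that] that Z by blast
  define d where "d = setdist {e} Y"
  have "Y \<noteq> {}"
    using subspace_0[OF assms(1)] by blast
  then have d: "d > 0"
    using assms(2,3) setdist_gt_0_compact_closed[of "{e}" Y] by (simp add: d_def)
  show thesis
  proof
    show "g y = 0" if "y \<in> Y" for y
      using geq[of y 0] that by simp
    show "g \<in> dual_on ?Z"
    proof (rule dual_onI[where K = "1 / d"])
      fix x y assume xy: "x \<in> ?Z" "y \<in> ?Z"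
      have "(x - g x *\<^sub>R e) + (y - g y *\<^sub>R e) \<in> Y"
        using assms(1) gY xy by (intro subspace_add)
      then show "g (x + y) = g x + g y"
        by (intro geq) (simp add: algebra_simps)
    next
      fix c x assume x: "x \<in> ?Z"
      have "c *\<^sub>R (x - g x *\<^sub>R e) \<in> Y"
        using assms(1) gY x by (intro subspace_scale)
      then show "g (c *\<^sub>R x) = c * g x"
        by (intro geq) (simp add: algebra_simps)
    next
      fix x assume x: "x \<in> ?Z"
      show "\<bar>g x\<bar> \<le> 1 / d * norm x"
      proof (cases "g x = 0")
        case False
        \<comment> \<open>This point of \<open>Y\<close> is \<open>e\<close> minus \<open>x\<close>
          divided by \<open>g x\<close>, so its distance to \<open>e\<close> is
          \<open>norm x / \<bar>g x\<bar>\<close>.\<close>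
        have "(- (1 / g x)) *\<^sub>R (x - g x *\<^sub>R e) \<in> Y"
          using assms(1) gY x by (intro subspace_scale)
        then have "d \<le> dist e ((- (1 / g x)) *\<^sub>R (x - g x *\<^sub>R e))"
          unfolding d_def by (intro setdist_le_dist) auto
        also have "\<dots> = norm ((1 / g x) *\<^sub>R x)"
          using False by (simp add: dist_norm algebra_simps)
        also have "\<dots> = norm x / \<bar>g x\<bar>"
          by simp
        finally show ?thesis
          using False d by (simp add: field_simps)
      qed (use d in simp)
    qed
  qed (use gY in auto)
qed

text \<open>Along a convergent sequence the Lipschitz coordinate is Cauchy and so converges in the
  reals; the components in \<open>Y\<close> then converge too, with limit in the closed set
  \<open>Y\<close>.\<close>

lemma closed_span_insert:
  fixes Y :: "'a::real_normed_vector set"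
  assumes "subspace Y" "closed Y"
  shows "closed (span (insert e Y))"
proof (cases "e \<in> Y")
  case True
  then show ?thesis
    using assms by (simp add: insert_absorb span_eq_iff[THEN iffD2])
next
  case False
  let ?Z = "span (insert e Y)"
  obtain g where g: "g \<in> dual_on ?Z" "\<And>z. z \<in> ?Z \<Longrightarrow> z - g z *\<^sub>R e \<in> Y"
    using coordinate_functional[OF assms False] by metis
  obtain K where lip: "K-lipschitz_on ?Z g"
    using dual_on_lipschitz[OF g(1) subspace_span] .
  show ?thesis
    unfolding closed_sequential_limits
  proof safe
    fix x l assume x: "\<forall>n. x n \<in> ?Z" and l: "x \<longlonglongrightarrow> l"
    have "Cauchy (\<lambda>n. g (x n))"
      using uniformly_continuous_imp_Cauchy_continuous[OF lipschitz_on_uniformly_continuous[OF lip]]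
        LIMSEQ_imp_Cauchy[OF l] x
      by (auto simp: Cauchy_continuous_on_def comp_def)
    then obtain t where t: "(\<lambda>n. g (x n)) \<longlonglongrightarrow> t"
      by (auto simp: Cauchy_convergent_iff convergent_def)
    have "(\<lambda>n. x n - g (x n) *\<^sub>R e) \<longlonglongrightarrow> l - t *\<^sub>R e"
      by (intro tendsto_intros l t)
    then have "l - t *\<^sub>R e \<in> Y"
      using assms(2) g(2) x closed_sequentially[of Y "\<lambda>n. x n - g (x n) *\<^sub>R e"] by blast
    then show "l \<in> ?Z"
      using assms(1) by (auto simp: span_insert span_eq_iff[THEN iffD2])
  qed
qed

section \<open>Adjoining one vector\<close>

lemma ball_huskable_span_insert:
  fixes Y :: "'a::real_normed_vector set"
  assumes Y: "subspace Y" "closed Y" and "ball_huskable Y"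
  shows "ball_huskable (span (insert e Y))"
proof (cases "e \<in> Y")
  case True
  then show ?thesis
    using assms by (simp add: insert_absorb span_eq_iff[THEN iffD2])
next
  case False
  let ?Z = "span (insert e Y)"
  have YZ: "Y \<subseteq> ?Z"
    using span_superset by blast
  obtain g where g: "g \<in> dual_on ?Z" "\<And>z. z \<in> ?Z \<Longrightarrow> z - g z *\<^sub>R e \<in> Y"
    and g0: "\<And>y. y \<in> Y \<Longrightarrow> g y = 0"
    using coordinate_functional[OF Y False] by metis
  obtain K where K: "\<And>x. x \<in> ?Z \<Longrightarrow> \<bar>g x\<bar> \<le> K * norm x"
    using g(1) unfolding dual_on_def by blast
  have gadd: "\<And>x y. x \<in> ?Z \<Longrightarrow> y \<in> ?Z \<Longrightarrow> g (x + y) = g x + g y"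
    and gscale: "\<And>c x. x \<in> ?Z \<Longrightarrow> g (c *\<^sub>R x) = c * g x"
    using g(1) by (auto simp: dual_on_def)
  show ?thesis
    unfolding ball_huskable_def
  proof (intro allI impI)
    fix \<epsilon> :: real assume \<epsilon>: "\<epsilon> > 0"
    then obtain W where W: "openin (subtopology (weak_topology_on Y) (unit_ball_of Y)) W"
        "W \<noteq> {}" "diameter W < \<epsilon> / 2"
      using \<open>ball_huskable Y\<close> unfolding ball_huskable_def by (meson half_gt_zero)
    obtain W' where W': "openin (weak_topology_on Y) W'" "W = W' \<inter> unit_ball_of Y"
      using W(1) by (auto simp: openin_subtopology)
    obtain y0 where y0: "y0 \<in> W'" "y0 \<in> Y" "norm y0 \<le> 1"
      using W(2) W'(2) by (auto simp: unit_ball_of_def)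
    \<comment> \<open>The value of \<open>diameter\<close> bounds distances only for bounded
      sets.\<close>
    have bW: "bounded W"
      unfolding bounded_iff W'(2) unit_ball_of_def by auto
    have "openin (top_of_set Y) W'"
      using openin_continuous_map_preimage[OF continuous_map_norm_weak[OF Y(1)] W'(1)]
        openin_subset[OF W'(1)] by (simp add: Collect_conj_eq Int_absorb1)
    then obtain O' where O': "open O'" "W' = Y \<inter> O'"
      by (auto simp: openin_open)
    \<comment> \<open>Since \<open>g y0 = 0\<close>, the map \<open>\<phi>\<close> below sends
      \<open>y0\<close> to \<open>y0\<close> divided by \<open>1 + \<eta>\<close>. For small \<eta>
      this remains in the norm-open set \<open>O'\<close>, which will make \<open>y0\<close> a
      witness that \<open>V\<close> is nonempty.\<close>
    have "((\<lambda>\<eta>. (1 / (1 + \<eta>)) *\<^sub>R y0) \<longlongrightarrow> (1 / (1 + 0)) *\<^sub>R y0) (at_right (0::real))"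
      by (intro tendsto_intros) simp
    then have "\<forall>\<^sub>F \<eta> in at_right (0::real). (1 / (1 + \<eta>)) *\<^sub>R y0 \<in> O'"
      using O' y0 by (intro topological_tendstoD) auto
    moreover have "\<forall>\<^sub>F \<eta> in at_right (0::real). 0 < \<eta> \<and> \<eta> < \<epsilon> / 16"
      using \<epsilon> by (auto simp: eventually_at_right_field intro!: exI[of _ "\<epsilon> / 16"])
    ultimately have "\<forall>\<^sub>F \<eta> in at_right (0::real).
        (1 / (1 + \<eta>)) *\<^sub>R y0 \<in> O' \<and> 0 < \<eta> \<and> \<eta> < \<epsilon> / 16"
      by eventually_elim auto
    then obtain \<eta> :: real where \<eta>: "(1 / (1 + \<eta>)) *\<^sub>R y0 \<in> O'" "0 < \<eta>" "\<eta> < \<epsilon> / 16"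
      using eventually_happens[of _ "at_right (0::real)"] by auto
    define \<phi> where "\<phi> z = (1 / (1 + \<eta>)) *\<^sub>R (z - g z *\<^sub>R e)" for z
    have \<phi>Y: "\<phi> z \<in> Y" if "z \<in> ?Z" for z
      unfolding \<phi>_def using Y(1) g(2)[OF that] by (rule subspace_scale)
    have \<phi>add: "\<phi> (x + y) = \<phi> x + \<phi> y" if "x \<in> ?Z" "y \<in> ?Z" for x y
      by (simp add: \<phi>_def gadd[OF that] algebra_simps)
    have \<phi>scale: "\<phi> (c *\<^sub>R x) = c *\<^sub>R \<phi> x" if "x \<in> ?Z" for c x
      by (simp add: \<phi>_def gscale[OF that] algebra_simps)
    \<comment> \<open>Any constant would do here: the bound only serves to make functionals on
      \<open>Y\<close> composed with \<open>\<phi>\<close> bounded. The sharp estimate on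
      \<open>V\<close> comes later.\<close>
    have \<phi>bound: "norm (\<phi> x) \<le> (1 + \<bar>K\<bar> * norm e) * norm x" if "x \<in> ?Z" for x
    proof -
      have "\<bar>g x\<bar> \<le> \<bar>K\<bar> * norm x"
        using K[OF that] by (rule order_trans) (simp add: mult_right_mono)
      then have ge: "\<bar>g x\<bar> * norm e \<le> \<bar>K\<bar> * norm x * norm e"
        by (rule mult_right_mono) simp
      have "norm (\<phi> x) = norm (x - g x *\<^sub>R e) / (1 + \<eta>)"
        using \<eta>(2) by (simp add: \<phi>_def)
      also have "\<dots> \<le> norm (x - g x *\<^sub>R e)"
        using \<eta>(2) by (simp add: divide_le_eq mult_left_le_one_le algebra_simps)
      also have "\<dots> \<le> norm x + \<bar>g x\<bar> * norm e"
        using norm_triangle_ineq4[of x "g x *\<^sub>R e"] by simp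
      also have "\<dots> \<le> (1 + \<bar>K\<bar> * norm e) * norm x"
        using ge by (simp add: algebra_simps)
      finally show ?thesis .
    qed
    have \<phi>cont: "continuous_map (weak_topology_on ?Z) (weak_topology_on Y) \<phi>"
    proof (rule continuous_map_weak_weak)
      fix f assume f: "f \<in> dual_on Y"
      then obtain L where L: "\<And>y. y \<in> Y \<Longrightarrow> \<bar>f y\<bar> \<le> L * norm y"
        unfolding dual_on_def by blast
      show "(\<lambda>x. f (\<phi> x)) \<in> dual_on ?Z"
      proof (rule dual_onI[where K = "\<bar>L\<bar> * (1 + \<bar>K\<bar> * norm e)"])
        fix x assume x: "x \<in> ?Z"
        have "\<bar>f (\<phi> x)\<bar> \<le> \<bar>L\<bar> * norm (\<phi> x)"
          using L[OF \<phi>Y[OF x]] by (rule order_trans) (simp add: mult_right_mono)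
        also have "\<dots> \<le> \<bar>L\<bar> * ((1 + \<bar>K\<bar> * norm e) * norm x)"
          using \<phi>bound[OF x] by (rule mult_left_mono) simp
        finally show "\<bar>f (\<phi> x)\<bar> \<le> \<bar>L\<bar> * (1 + \<bar>K\<bar> * norm e) * norm x"
          by (simp add: mult.assoc)
      qed (use f in \<open>auto simp: \<phi>add \<phi>scale \<phi>Y dual_on_def\<close>)
    qed (rule \<phi>Y)
    define N where "N = {z \<in> ?Z. \<phi> z \<in> W'} \<inter> {z \<in> ?Z. g z \<in> {t. \<bar>t\<bar> * norm e < \<eta>}}"
    define V where "V = N \<inter> unit_ball_of ?Z"
    have "open {t. \<bar>t\<bar> * norm e < \<eta>}"
      by (intro open_Collect_less continuous_intros)
    then have "openin (weak_topology_on ?Z) N"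
      unfolding N_def
      using openin_continuous_map_preimage[OF \<phi>cont W'(1)]
      by (intro openin_Int openin_weak_topology_on_vimage[OF g(1)]) auto
    then have "openin (subtopology (weak_topology_on ?Z) (unit_ball_of ?Z)) V"
      by (auto simp: V_def openin_subtopology)
    moreover have "y0 \<in> V"
    proof -
      have "\<phi> y0 \<in> Y"
        using \<phi>Y y0(2) YZ by blast
      then show ?thesis
        using y0 YZ \<eta> O' g0[OF y0(2)] by (auto simp: V_def N_def unit_ball_of_def \<phi>_def)
    qed
    moreover have near: "\<phi> z \<in> W" "dist z (\<phi> z) \<le> 2 * \<eta>" if "z \<in> V" for z
    proof -
      have z: "z \<in> ?Z" "\<phi> z \<in> W'" "\<bar>g z\<bar> * norm e < \<eta>" "norm z \<le> 1"
        using that by (auto simp: V_def N_def unit_ball_of_def)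
      \<comment> \<open>Removing the \<open>e\<close> component can push \<open>z\<close> out of the
        unit ball by at most \<eta>; the factor in \<open>\<phi>\<close> compensates exactly for
        this.\<close>
      have "norm (z - g z *\<^sub>R e) \<le> 1 + \<eta>"
        using norm_triangle_ineq4[of z "g z *\<^sub>R e"] z by simp
      moreover have "norm (\<phi> z) = norm (z - g z *\<^sub>R e) / (1 + \<eta>)"
        using \<eta>(2) by (simp add: \<phi>_def)
      ultimately have \<phi>1: "norm (\<phi> z) \<le> 1"
        using \<eta>(2) by (simp add: divide_le_eq)
      then show "\<phi> z \<in> W"
        using z \<phi>Y by (auto simp: W'(2) unit_ball_of_def)
      have "(1 + \<eta>) *\<^sub>R \<phi> z = z - g z *\<^sub>R e"
        using \<eta>(2) by (simp add: \<phi>_def)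
      then have "z - \<phi> z = g z *\<^sub>R e + \<eta> *\<^sub>R \<phi> z"
        by (simp add: algebra_simps)
      then have "dist z (\<phi> z) \<le> \<bar>g z\<bar> * norm e + \<eta> * norm (\<phi> z)"
        using norm_triangle_ineq[of "g z *\<^sub>R e" "\<eta> *\<^sub>R \<phi> z"] \<eta>(2) by (simp add: dist_norm)
      also have "\<dots> \<le> \<eta> + \<eta> * 1"
        using z(3) \<phi>1 \<eta>(2) by (intro add_mono mult_left_mono) auto
      finally show "dist z (\<phi> z) \<le> 2 * \<eta>"
        by simp
    qed
    moreover have "diameter V < \<epsilon>"
    proof -
      \<comment> \<open>Each of the two points moves by at most \<open>2 * \<eta>\<close>. With
        \<open>\<eta> < \<epsilon> / 16\<close> the total is below
        \<open>\<epsilon> / 2 + \<epsilon> / 4\<close>.\<close>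
      have "diameter V \<le> diameter W + 4 * \<eta>"
      proof (rule diameter_le)
        show "V \<noteq> {} \<or> 0 \<le> diameter W + 4 * \<eta>"
          using \<open>y0 \<in> V\<close> by blast
        fix x y assume xy: "x \<in> V" "y \<in> V"
        have "dist x y \<le> dist x (\<phi> x) + dist (\<phi> x) (\<phi> y) + dist y (\<phi> y)"
          by metric
        moreover have "dist (\<phi> x) (\<phi> y) \<le> diameter W"
          using diameter_bounded_bound[OF bW] near xy by blast
        ultimately show "norm (x - y) \<le> diameter W + 4 * \<eta>"
          using near(2)[OF xy(1)] near(2)[OF xy(2)] by (simp add: dist_norm)
      qed
      with W(3) \<eta>(3) \<epsilon> show ?thesis by simp
    qed
    ultimately show "\<exists>V. openin (subtopology (weak_topology_on ?Z) (unit_ball_of ?Z)) V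
        \<and> V \<noteq> {} \<and> diameter V < \<epsilon>"
      by blast
  qed
qed

section \<open>Finite-dimensional quotients\<close>

text \<open>Closedness is carried through the induction because adjoining the next vector requires
  it.\<close>

lemma ball_huskable_span_Un:
  fixes Y :: "'a::real_normed_vector set"
  assumes "finite H" "subspace Y" "closed Y" "ball_huskable Y"
  shows "closed (span (H \<union> Y)) \<and> ball_huskable (span (H \<union> Y))"
  using assms(1)
proof induction
  case empty
  then show ?case
    using assms by (simp add: span_eq_iff[THEN iffD2])
next
  case (insert e H)
  have "span (insert e H \<union> Y) = span (insert e (span (H \<union> Y)))"
    by (simp add: span_insert span_span)
  then show ?case
    using insert.IH closed_span_insert ball_huskable_span_insert subspace_span by metis
qed

text \<open>Take one representative \<open>r A\<close> of each generating coset. By induction every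
  coset in \<open>quotient_span Y G\<close> lies inside the span of these representatives and
  \<open>Y\<close>, and each vector belongs to its own coset.\<close>

lemma finite_dim_quotient_span:
  assumes "subspace Y" "finite_dim_quotient Y"
  obtains H where "finite H" "span (H \<union> Y) = UNIV"
proof -
  obtain G where G: "finite G" "G \<subseteq> quotient_by Y" "quotient_span Y G = quotient_by Y"
    using assms(2) by (auto simp: finite_dim_quotient_def)
  have "\<forall>A\<in>G. \<exists>x. A = x +o Y"
    using G(2) by (auto simp: quotient_by_def)
  then obtain r where r: "\<And>A. A \<in> G \<Longrightarrow> A = r A +o Y"
    by metis
  let ?S = "span (r ` G \<union> Y)"
  have YS: "Y \<subseteq> ?S"
    using span_superset by blast
  have sub: "A \<subseteq> ?S" if "A \<in> quotient_span Y G" for A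
    using that
  proof induction
    case (base A)
    then have "r A \<in> ?S"
      by (intro span_base) blast
    then have "r A +o Y \<subseteq> ?S"
      using YS by (auto simp: elt_set_plus_def intro: span_add)
    then show ?case
      using r[OF base] by simp
  next
    case (add A B)
    then show ?case
      by (auto simp: set_plus_def intro: span_add)
  next
    case (scale A c)
    then show ?case
      using YS by (auto simp: quotient_scale_def set_plus_def intro!: span_add span_scale)
  qed (rule YS)
  have "x \<in> ?S" for x
  proof -
    have "x \<in> x +o Y"
      using subspace_0[OF assms(1)] by (force simp: elt_set_plus_def)
    moreover have "x +o Y \<in> quotient_span Y G"
      using G(3) by (auto simp: quotient_by_def)
    ultimately show ?thesis
      using sub by blast
  qed
  with G(1) that[of "r ` G"] show thesis
    by blast
qed

theorem proposition4p3:
  fixes Y :: "'a::banach set"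
  assumes "(UNIV :: 'a set) \<noteq> {0}"
    and "subspace Y" and "closed Y" and "Y \<noteq> {0}"
    and "finite_dim_quotient Y"
    and "ball_huskable Y"
  shows "ball_huskable (UNIV :: 'a set)"
proof -
  obtain H where "finite H" "span (H \<union> Y) = UNIV"
    using finite_dim_quotient_span[OF \<open>subspace Y\<close> \<open>finite_dim_quotient Y\<close>] .
  then show ?thesis
    using ball_huskable_span_Un[of H Y] assms by simp
qed

end
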